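(* Let $X$ be a Bruck loop (not necessarily finite) and let $x,y\in X$ with $x$ a $2$-element (i.e. the order of $x$ is a power of $2$) and $y$ an element of (finite) odd order. Then $R(x)R(y)=R(x\circ y)=R(y\circ x)=R(y)R(x)$. Hence $x\circ y=y\circ x$.
   Context: A loop is a set $X$ with a binary operation $\circ$ and an identity $1$ such that all maps $R(x):y\mapsto y\circ x$ and $L(x):y\mapsto x\circ y$ are permutations of $X$. A (right) Bol loop is a loop satisfying $((z\circ x)\circ y)\circ x=z\circ((x\circ y)\circ x)$ for all $x,y,z$. In a Bol loop the subloop $\langle x\rangle$ generated by any $x$ is a group; $x^{-1}$ and the order $|x|$ are computed in that group. A Bruck loop is a Bol loop with $(x\circ y)^{-1}=x^{-1}\circ y^{-1}$ for all $x,y$. Permutations are written on the right and composed left to right. *)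

theory Defs
  imports "HOL-Algebra.Multiplicative_Group"
begin

text \<open>
  Loops are carried by HOL-Algebra's monoid records, of which only the signature (carrier,
  multiplication, identity) is used.  Translations are restricted to the carrier (they take
  the value \<^const>\<open>undefined\<close> outside), so that equality of translations as HOL functions
  is equality of permutations of the carrier.
\<close>

definition right_translation :: "('a, 'b) monoid_scheme \<Rightarrow> 'a \<Rightarrow> 'a \<Rightarrow> 'a" where
  "right_translation X x = restrict (\<lambda>y. y \<otimes>\<^bsub>X\<^esub> x) (carrier X)"

definition left_translation :: "('a, 'b) monoid_scheme \<Rightarrow> 'a \<Rightarrow> 'a \<Rightarrow> 'a" where
  "left_translation X x = restrict (\<lambda>y. x \<otimes>\<^bsub>X\<^esub> y) (carrier X)"

text \<open>Permutations act on the right, so in the product \<open>f g\<close> the factor \<open>f\<close> is applied first.\<close>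

definition perm_prod ::
  "('a, 'b) monoid_scheme \<Rightarrow> ('a \<Rightarrow> 'a) \<Rightarrow> ('a \<Rightarrow> 'a) \<Rightarrow> 'a \<Rightarrow> 'a" where
  "perm_prod X f g = compose (carrier X) g f"

locale loop =
  fixes X (structure)
  assumes one_in_carrier: "\<one> \<in> carrier X"
    and left_one: "x \<in> carrier X \<Longrightarrow> \<one> \<otimes> x = x"
    and right_one: "x \<in> carrier X \<Longrightarrow> x \<otimes> \<one> = x"
    and right_translation_bij:
      "x \<in> carrier X \<Longrightarrow> bij_betw (right_translation X x) (carrier X) (carrier X)"
    and left_translation_bij:
      "x \<in> carrier X \<Longrightarrow> bij_betw (left_translation X x) (carrier X) (carrier X)"

locale bol_loop = loop +
  assumes bol: "\<lbrakk>x \<in> carrier X; y \<in> carrier X; z \<in> carrier X\<rbrakk> \<Longrightarrow>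
    ((z \<otimes> x) \<otimes> y) \<otimes> x = z \<otimes> ((x \<otimes> y) \<otimes> x)"

definition subloop :: "'a set \<Rightarrow> ('a, 'b) monoid_scheme \<Rightarrow> bool" where
  "subloop H X \<longleftrightarrow> H \<subseteq> carrier X \<and> loop (X\<lparr>carrier := H\<rparr>)"

definition gen_subloop :: "('a, 'b) monoid_scheme \<Rightarrow> 'a \<Rightarrow> ('a, 'b) monoid_scheme" where
  "gen_subloop X x = X\<lparr>carrier := \<Inter>{H. subloop H X \<and> x \<in> H}\<rparr>"

text \<open>
  Inverses and orders are those of HOL-Algebra in the subloop generated by the element, which
  is a group whenever \<open>X\<close> is a Bol loop.  As for \<^const>\<open>group.ord\<close>, order 0 means infinite order.
\<close>

definition loop_inv :: "('a, 'b) monoid_scheme \<Rightarrow> 'a \<Rightarrow> 'a" where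
  "loop_inv X x = inv\<^bsub>gen_subloop X x\<^esub> x"

definition loop_ord :: "('a, 'b) monoid_scheme \<Rightarrow> 'a \<Rightarrow> nat" where
  "loop_ord X x = group.ord (gen_subloop X x) x"

locale bruck_loop = bol_loop +
  assumes inv_mult: "\<lbrakk>x \<in> carrier X; y \<in> carrier X\<rbrakk> \<Longrightarrow>
    loop_inv X (x \<otimes> y) = loop_inv X x \<otimes> loop_inv X y"

end

theory Submission
  imports Defs "HOL-Algebra.Bij"
begin

text \<open>
  Write \<open>R x\<close> for the right translation by \<open>x\<close>. The set \<open>K\<close> of all right translations sits in
  the group of permutations of the loop, and the Bol identity says exactly that \<open>K\<close> is closed
  under \<open>a, b \<mapsto> a b a\<close>. Moreover \<open>K\<close> contains inverses, hence all integer powers of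
  its elements, and a member of \<open>K\<close> is determined by its value at the identity of the loop.
  For members of \<open>K\<close> the order of \<open>x\<close> as a loop element may therefore be replaced by a power
  equation for \<open>R x\<close>.

  The Bruck identity enters through its consequence \<open>(x y)\<^sup>2 = (y x\<^sup>2) y\<close>. With
  \<open>a = R x\<close>, \<open>b = R y\<close> and \<open>c = R (x y)\<close> it becomes \<open>c\<^sup>2 = b a\<^sup>2 b\<close>. Suppose that
  \<open>a\<close> has order \<open>2\<^sup>k\<close> and \<open>b\<close> has odd order, and argue by induction on \<open>k\<close>. By induction
  \<open>a\<^sup>2 = R (x\<^sup>2)\<close> commutes with \<open>b\<close>, so \<open>c\<^sup>2\<close> is the product of the commuting elements
  \<open>a\<^sup>2\<close> and \<open>b\<^sup>2\<close> of coprime orders. Hence \<open>b\<close> is a power of \<open>c\<^sup>2\<close> and commutes with \<open>c\<close>.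
  Since \<open>b\<close> has odd order, \<open>b\<^sup>-\<^sup>1\<close> is the square of a power \<open>d\<close> of \<open>b\<close>, and so
  \<open>c b\<^sup>-\<^sup>1 = d c d\<close> is again in \<open>K\<close>. It sends the identity to \<open>x\<close>, so it is \<open>a\<close>. Thus
  \<open>a b = c\<close>, and \<open>a\<close> commutes with \<open>b\<close> because \<open>c\<close> does.

  The step \<open>square_of_product\<close> is where Bruck enters, and \<open>R_mult_if_two_element_odd\<close> is the
  induction. The translation between orders in the loop and in the permutation group is
  \<open>R_pow_loop_ord\<close>.
\<close>

section \<open>Commuting elements of coprime orders\<close>

lemma (in group) pow_eq_self_if_odd_order:
  assumes b: "b \<in> carrier G" and m: "b [^] m = \<one>" "odd (m::nat)"
  obtains N :: nat where "b [^] (2 ^ k * N) = b"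
proof -
  have "gcd (2 ^ k) m = 1" using m(2) by simp
  then obtain N q where "2 ^ k * N = m * q + 1"
    using bezout_nat[of "2 ^ k" m] by auto
  then have "b [^] (2 ^ k * N) = (b [^] m) [^] q \<otimes> b"
    using b by (simp add: nat_pow_pow)
  then show thesis using that m(1) b by simp
qed

text \<open>
  A suitable power of the square of \<open>c\<close> kills the factor \<open>s\<close> of 2-power order and fixes \<open>b\<close>,
  so \<open>b\<close> is a power of \<open>c\<close>.
\<close>

lemma (in group) commutes_if_square_eq_odd_times_two_part:
  assumes carr: "s \<in> carrier G" "b \<in> carrier G" "c \<in> carrier G"
    and sb: "s \<otimes> b = b \<otimes> s"
    and s: "s [^] (2 ^ k :: nat) = \<one>"
    and b: "b [^] m = \<one>" "odd (m::nat)"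
    and cc: "c \<otimes> c = s \<otimes> (b \<otimes> b)"
  shows "c \<otimes> b = b \<otimes> c"
proof -
  obtain N :: nat where N: "b [^] (2 ^ Suc k * N) = b"
    using pow_eq_self_if_odd_order[OF carr(2) b] by blast
  \<comment> \<open>Half of that exponent, because the square of \<open>c\<close> involves the square of \<open>b\<close>.\<close>
  define n where "n = 2 ^ k * N"
  have "s \<otimes> (b \<otimes> b) = (b \<otimes> b) \<otimes> s"
    using sb carr by (metis m_assoc)
  then have "(c \<otimes> c) [^] n = s [^] n \<otimes> (b \<otimes> b) [^] n"
    unfolding cc using carr by (intro pow_mult_distrib) simp_all
  also have "s [^] n = \<one>"
    using nat_pow_pow[OF carr(1), of "2 ^ k" N] s by (simp add: n_def)
  also have "(b \<otimes> b) [^] n = b [^] (2 ^ Suc k * N)"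
    using nat_pow_pow[OF carr(2), of 2 n] carr by (simp add: n_def numeral_2_eq_2 add_mult_distrib)
  finally have "(c \<otimes> c) [^] n = b" using N carr by simp
  moreover have "c \<otimes> (c \<otimes> c) [^] n = (c \<otimes> c) [^] n \<otimes> c"
    using group_commutes_pow[of "c \<otimes> c" c n] carr by (simp add: m_assoc)
  ultimately show ?thesis by simp
qed

section \<open>Right translations and subloops\<close>

context loop
begin

text \<open>
  Products in this group are compositions of functions: the right factor acts first, the
  opposite of \<^const>\<open>perm_prod\<close>.
\<close>

abbreviation Sym :: "('a \<Rightarrow> 'a) monoid" where "Sym \<equiv> BijGroup (carrier X)"

abbreviation R :: "'a \<Rightarrow> 'a \<Rightarrow> 'a" where "R \<equiv> right_translation X"

lemma group_Sym: "group Sym"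
  by (rule group_BijGroup)

lemma mult_closed: "x \<in> carrier X \<Longrightarrow> y \<in> carrier X \<Longrightarrow> x \<otimes> y \<in> carrier X"
  using right_translation_bij[of y] by (auto simp: bij_betw_def right_translation_def)

lemma R_closed: "x \<in> carrier X \<Longrightarrow> R x \<in> carrier Sym"
  using right_translation_bij by (auto simp: BijGroup_def Bij_def right_translation_def)

lemma Sym_mult_apply:
  assumes "f \<in> carrier Sym" "g \<in> carrier Sym" "z \<in> carrier X"
  shows "(f \<otimes>\<^bsub>Sym\<^esub> g) z = f (g z)"
  using assms by (simp add: BijGroup_def compose_def)

lemma R_apply: "z \<in> carrier X \<Longrightarrow> R x z = z \<otimes> x"
  by (simp add: right_translation_def)

lemma R_one: "R \<one> = \<one>\<^bsub>Sym\<^esub>"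
  using right_one by (auto simp: BijGroup_def right_translation_def)

lemma R_eqI_at_one: "R u = f \<Longrightarrow> u \<in> carrier X \<Longrightarrow> u = f \<one>"
  using R_apply[OF one_in_carrier] left_one by force

lemma R_mult_at_one:
  assumes "x \<in> carrier X" "y \<in> carrier X"
  shows "(R y \<otimes>\<^bsub>Sym\<^esub> R x) \<one> = x \<otimes> y"
  using assms by (simp add: Sym_mult_apply R_closed one_in_carrier R_apply left_one)

lemma Sym_eqI:
  assumes "f \<in> carrier Sym" "g \<in> carrier Sym" "\<And>z. z \<in> carrier X \<Longrightarrow> f z = g z"
  shows "f = g"
  using assms by (auto simp: BijGroup_def Bij_def intro: extensionalityI)

lemma left_cancel:
  "x \<otimes> y = x \<otimes> z \<Longrightarrow> x \<in> carrier X \<Longrightarrow> y \<in> carrier X \<Longrightarrow> z \<in> carrier X \<Longrightarrow> y = z"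
  using left_translation_bij[of x] by (auto simp: bij_betw_def inj_on_def left_translation_def)

lemma right_cancel:
  "y \<otimes> x = z \<otimes> x \<Longrightarrow> x \<in> carrier X \<Longrightarrow> y \<in> carrier X \<Longrightarrow> z \<in> carrier X \<Longrightarrow> y = z"
  using right_translation_bij[of x] by (auto simp: bij_betw_def inj_on_def right_translation_def)

lemma left_divide:
  assumes "x \<in> carrier X" "z \<in> carrier X" obtains w where "w \<in> carrier X" "x \<otimes> w = z"
proof -
  have "z \<in> left_translation X x ` carrier X"
    using left_translation_bij[of x] assms by (simp add: bij_betw_def)
  then show thesis using that by (auto simp: left_translation_def)
qed

lemma right_divide:
  assumes "x \<in> carrier X" "z \<in> carrier X" obtains w where "w \<in> carrier X" "w \<otimes> x = z"
proof -
  have "z \<in> R x ` carrier X"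
    using right_translation_bij[of x] assms by (simp add: bij_betw_def)
  then show thesis using that by (auto simp: right_translation_def)
qed

text \<open>
  Characterizing subloops by closure under multiplication and both divisions makes it evident
  that intersections of subloops are subloops.
\<close>

lemma subloopI:
  assumes sub: "H \<subseteq> carrier X" and one: "\<one> \<in> H"
    and mult: "\<And>u v. u \<in> H \<Longrightarrow> v \<in> H \<Longrightarrow> u \<otimes> v \<in> H"
    and left: "\<And>u v. u \<in> H \<Longrightarrow> v \<in> carrier X \<Longrightarrow> u \<otimes> v \<in> H \<Longrightarrow> v \<in> H"
    and right: "\<And>u v. u \<in> H \<Longrightarrow> v \<in> carrier X \<Longrightarrow> v \<otimes> u \<in> H \<Longrightarrow> v \<in> H"
  shows "subloop H X"
  unfolding subloop_def
proof (intro conjI sub)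
  show "loop (X\<lparr>carrier := H\<rparr>)"
  proof (unfold_locales, simp_all add: one left_one right_one subsetD[OF sub])
    fix u assume u: "u \<in> H"
    then have uX: "u \<in> carrier X" using sub by blast
    show "bij_betw (right_translation (X\<lparr>carrier := H\<rparr>) u) H H"
    proof (rule bij_betw_imageI)
      show "inj_on (right_translation (X\<lparr>carrier := H\<rparr>) u) H"
        using right_cancel uX sub by (auto simp: inj_on_def right_translation_def)
      have "z \<in> right_translation (X\<lparr>carrier := H\<rparr>) u ` H" if zH: "z \<in> H" for z
      proof -
        obtain w where w: "w \<in> carrier X" "w \<otimes> u = z"
          using right_divide[OF uX, of z] zH sub by blast
        then have "w \<in> H" using right[OF u] zH by simp
        then show ?thesis using w by (auto simp: right_translation_def)
      qed
      then show "right_translation (X\<lparr>carrier := H\<rparr>) u ` H = H"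
        using mult u by (auto simp: right_translation_def)
    qed
    show "bij_betw (left_translation (X\<lparr>carrier := H\<rparr>) u) H H"
    proof (rule bij_betw_imageI)
      show "inj_on (left_translation (X\<lparr>carrier := H\<rparr>) u) H"
        using left_cancel uX sub by (auto simp: inj_on_def left_translation_def)
      have "z \<in> left_translation (X\<lparr>carrier := H\<rparr>) u ` H" if zH: "z \<in> H" for z
      proof -
        obtain w where w: "w \<in> carrier X" "u \<otimes> w = z"
          using left_divide[OF uX, of z] zH sub by blast
        then have "w \<in> H" using left[OF u] zH by simp
        then show ?thesis using w by (auto simp: left_translation_def)
      qed
      then show "left_translation (X\<lparr>carrier := H\<rparr>) u ` H = H"
        using mult u by (auto simp: left_translation_def)
    qed
  qed
qed

lemma subloop_mult: "subloop H X \<Longrightarrow> u \<in> H \<Longrightarrow> v \<in> H \<Longrightarrow> u \<otimes> v \<in> H"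
  using loop.mult_closed[of "X\<lparr>carrier := H\<rparr>" u v] by (simp add: subloop_def)

lemma subloop_one: "subloop H X \<Longrightarrow> \<one> \<in> H"
  using loop.one_in_carrier[of "X\<lparr>carrier := H\<rparr>"] by (simp add: subloop_def)

lemma subloop_left_divide:
  assumes H: "subloop H X" and "u \<in> H" "v \<in> carrier X" "u \<otimes> v \<in> H"
  shows "v \<in> H"
proof -
  have "H \<subseteq> carrier X" using H by (simp add: subloop_def)
  obtain w where "w \<in> H" "u \<otimes> w = u \<otimes> v"
    using loop.left_divide[of "X\<lparr>carrier := H\<rparr>" u "u \<otimes> v"] assms by (auto simp: subloop_def)
  then show ?thesis using left_cancel[of u w v] assms \<open>H \<subseteq> carrier X\<close> by auto
qed

lemma subloop_right_divide:
  assumes H: "subloop H X" and "u \<in> H" "v \<in> carrier X" "v \<otimes> u \<in> H"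
  shows "v \<in> H"
proof -
  have "H \<subseteq> carrier X" using H by (simp add: subloop_def)
  obtain w where "w \<in> H" "w \<otimes> u = v \<otimes> u"
    using loop.right_divide[of "X\<lparr>carrier := H\<rparr>" u "v \<otimes> u"] assms by (auto simp: subloop_def)
  then show ?thesis using right_cancel[of w u v] assms \<open>H \<subseteq> carrier X\<close> by auto
qed

lemma subloop_carrier: "subloop (carrier X) X"
  by (rule subloopI) (auto simp: one_in_carrier mult_closed)

lemma carrier_gen_subloop_subset:
  assumes "subloop H X" "x \<in> H" shows "carrier (gen_subloop X x) \<subseteq> H"
  using assms by (auto simp: gen_subloop_def)

lemma subloop_gen_subloop:
  assumes "x \<in> carrier X"
  shows "subloop (carrier (gen_subloop X x)) X"
proof (rule subloopI)
  show "carrier (gen_subloop X x) \<subseteq> carrier X"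
    by (rule carrier_gen_subloop_subset[OF subloop_carrier assms])
qed (auto simp: gen_subloop_def intro: subloop_one subloop_mult subloop_left_divide
      subloop_right_divide)

end

section \<open>Powers and orders in a Bol loop\<close>

context bol_loop
begin

lemma R_sandwich:
  assumes "x \<in> carrier X" "y \<in> carrier X"
  shows "R x \<otimes>\<^bsub>Sym\<^esub> R y \<otimes>\<^bsub>Sym\<^esub> R x = R ((x \<otimes> y) \<otimes> x)"
proof -
  interpret S: group Sym by (rule group_Sym)
  show ?thesis
    using assms
    by (intro Sym_eqI) (simp_all add: R_closed mult_closed Sym_mult_apply R_apply bol)
qed

text \<open>
  The right inverse property. A left inverse \<open>u\<close> of \<open>x\<close> serves: the Bol identity with
  \<open>z = u\<close> gives \<open>(x u) x = x\<close>, so \<open>R x (R u) (R x) = R x\<close>.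
\<close>

lemma inv_R_ex:
  assumes x: "x \<in> carrier X"
  shows "\<exists>u\<in>carrier X. R u = inv\<^bsub>Sym\<^esub> (R x)"
proof -
  interpret S: group Sym by (rule group_Sym)
  obtain u where u: "u \<in> carrier X" "u \<otimes> x = \<one>"
    using right_divide[OF x one_in_carrier] by blast
  have "u \<otimes> ((x \<otimes> u) \<otimes> x) = u \<otimes> x"
    using bol[OF x u(1) u(1)] u by (simp add: left_one)
  then have "(x \<otimes> u) \<otimes> x = x"
    using left_cancel u x mult_closed by metis
  then have "R x \<otimes>\<^bsub>Sym\<^esub> R u \<otimes>\<^bsub>Sym\<^esub> R x = R x"
    using R_sandwich[OF x u(1)] by simp
  then have "R x \<otimes>\<^bsub>Sym\<^esub> R u = \<one>\<^bsub>Sym\<^esub>"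
    using R_closed[OF x] R_closed[OF u(1)] by (simp add: S.r_cancel_one)
  then have "R u = inv\<^bsub>Sym\<^esub> (R x)"
    using R_closed[OF x] R_closed[OF u(1)] S.inv_equality S.inv_inv S.inv_closed by metis
  then show ?thesis using u by blast
qed

text \<open>Sandwiching a power of \<open>R x\<close> by \<open>R x\<close> raises the exponent by two.\<close>

lemma R_nat_pow_ex:
  assumes x: "x \<in> carrier X"
  shows "\<exists>u\<in>carrier X. R u = R x [^]\<^bsub>Sym\<^esub> (n::nat)"
proof (induction n rule: induct_nat_012)
  interpret S: group Sym by (rule group_Sym)
  case 0
  then show ?case using R_one one_in_carrier by auto
next
  interpret S: group Sym by (rule group_Sym)
  case 1
  then show ?case using x R_closed by auto
next
  interpret S: group Sym by (rule group_Sym)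
  case (ge2 n)
  then obtain u where u: "u \<in> carrier X" "R u = R x [^]\<^bsub>Sym\<^esub> n" by blast
  have "R ((x \<otimes> u) \<otimes> x) = R x \<otimes>\<^bsub>Sym\<^esub> R x [^]\<^bsub>Sym\<^esub> n \<otimes>\<^bsub>Sym\<^esub> R x"
    using R_sandwich[OF x u(1)] u(2) by simp
  also have "\<dots> = R x [^]\<^bsub>Sym\<^esub> Suc (Suc n)"
    using R_closed[OF x] S.nat_pow_Suc2[of "R x" n] by simp
  finally show ?case using x u mult_closed by blast
qed

lemma R_int_pow_ex:
  assumes x: "x \<in> carrier X"
  shows "\<exists>u\<in>carrier X. R u = R x [^]\<^bsub>Sym\<^esub> (i::int)"
proof (cases i rule: int_cases2)
  case (nonneg n)
  then show ?thesis using R_nat_pow_ex[OF x, of n] by (simp add: int_pow_int)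
next
  interpret S: group Sym by (rule group_Sym)
  case (nonpos n)
  obtain u where "u \<in> carrier X" "R u = R x [^]\<^bsub>Sym\<^esub> n"
    using R_nat_pow_ex[OF x, of n] by blast
  then show ?thesis using inv_R_ex[of u] nonpos R_closed[OF x]
    by (simp add: S.int_pow_neg int_pow_int)
qed

text \<open>
  The cyclic group generated by \<open>x\<close>, described through \<open>R\<close> since powers in a loop are not
  yet known to be well behaved. It is a subloop on which \<open>R\<close> is multiplicative, so it bounds
  the subloop generated by \<open>x\<close> from above and makes it associative.
\<close>

definition int_powers :: "'a \<Rightarrow> 'a set" where
  "int_powers x = {u \<in> carrier X. \<exists>i::int. R u = R x [^]\<^bsub>Sym\<^esub> i}"

text \<open>
  The product of the two translations is a power of \<open>R x\<close>, hence itself a right translation;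
  evaluating at the identity shows which one.
\<close>

lemma R_mult_int_powers:
  assumes x: "x \<in> carrier X" and uv: "u \<in> int_powers x" "v \<in> int_powers x"
  shows "R (u \<otimes> v) = R v \<otimes>\<^bsub>Sym\<^esub> R u"
proof -
  interpret S: group Sym by (rule group_Sym)
  obtain i j :: int where ij: "R u = R x [^]\<^bsub>Sym\<^esub> i" "R v = R x [^]\<^bsub>Sym\<^esub> j"
    and carr: "u \<in> carrier X" "v \<in> carrier X"
    using uv by (auto simp: int_powers_def)
  obtain w where w: "w \<in> carrier X" "R w = R x [^]\<^bsub>Sym\<^esub> (j + i)"
    using R_int_pow_ex[OF x] by blast
  then have "R w = R v \<otimes>\<^bsub>Sym\<^esub> R u"
    using ij R_closed[OF x] by (simp add: S.int_pow_mult)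
  moreover from this have "w = u \<otimes> v"
    using R_eqI_at_one[of w] w(1) R_mult_at_one carr by simp
  ultimately show ?thesis by simp
qed

lemma mem_int_powersI:
  assumes "u \<in> carrier X" "R u = R x [^]\<^bsub>Sym\<^esub> (i::int)" shows "u \<in> int_powers x"
  using assms by (auto simp: int_powers_def)

lemma self_in_int_powers: "x \<in> carrier X \<Longrightarrow> x \<in> int_powers x"
  by (rule mem_int_powersI[of _ _ 1]) (simp_all add: group.int_pow_1[OF group_Sym] R_closed)

lemma subloop_int_powers:
  assumes x: "x \<in> carrier X"
  shows "subloop (int_powers x) X"
proof (rule subloopI)
  interpret S: group Sym by (rule group_Sym)
  note Rx = R_closed[OF x]
  show "int_powers x \<subseteq> carrier X" by (auto simp: int_powers_def)
  show "\<one> \<in> int_powers x"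
    by (rule mem_int_powersI[of _ _ 0]) (simp_all add: one_in_carrier R_one)
  fix u assume u: "u \<in> int_powers x"
  then obtain i :: int where i: "u \<in> carrier X" "R u = R x [^]\<^bsub>Sym\<^esub> i"
    by (auto simp: int_powers_def)
  show "u \<otimes> v \<in> int_powers x" if v: "v \<in> int_powers x" for v
  proof -
    obtain j :: int where j: "v \<in> carrier X" "R v = R x [^]\<^bsub>Sym\<^esub> j"
      using v by (auto simp: int_powers_def)
    have "R (u \<otimes> v) = R x [^]\<^bsub>Sym\<^esub> (j + i)"
      using R_mult_int_powers[OF x u v] i j Rx by (simp add: S.int_pow_mult)
    then show ?thesis using mem_int_powersI mult_closed i j by blast
  qed
  fix v assume v: "v \<in> carrier X"
  {
    assume uv: "u \<otimes> v \<in> int_powers x"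
    then obtain j :: int where j: "R (u \<otimes> v) = R x [^]\<^bsub>Sym\<^esub> j"
      by (auto simp: int_powers_def)
    obtain w where w: "w \<in> carrier X" "R w = R x [^]\<^bsub>Sym\<^esub> (j - i)"
      using R_int_pow_ex[OF x] by blast
    then have wP: "w \<in> int_powers x" by (rule mem_int_powersI)
    have "R (u \<otimes> w) = R x [^]\<^bsub>Sym\<^esub> j"
      using R_mult_int_powers[OF x u wP] w i Rx by (simp flip: S.int_pow_mult)
    then have "u \<otimes> w = u \<otimes> v"
      using j R_eqI_at_one[of "u \<otimes> w"] R_eqI_at_one[of "u \<otimes> v"] mult_closed i v w by simp
    then have "w = v" using left_cancel i v w by blast
    then show "v \<in> int_powers x" using wP by simp
  }
  {
    assume uv: "v \<otimes> u \<in> int_powers x"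
    then obtain j :: int where j: "R (v \<otimes> u) = R x [^]\<^bsub>Sym\<^esub> j"
      by (auto simp: int_powers_def)
    obtain w where w: "w \<in> carrier X" "R w = R x [^]\<^bsub>Sym\<^esub> (-i + j)"
      using R_int_pow_ex[OF x] by blast
    then have wP: "w \<in> int_powers x" by (rule mem_int_powersI)
    have "R (w \<otimes> u) = R x [^]\<^bsub>Sym\<^esub> j"
      using R_mult_int_powers[OF x wP u] w i Rx by (simp flip: S.int_pow_mult)
    then have "w \<otimes> u = v \<otimes> u"
      using j R_eqI_at_one[of "w \<otimes> u"] R_eqI_at_one[of "v \<otimes> u"] mult_closed i v w by simp
    then have "w = v" using right_cancel i v w by blast
    then show "v \<in> int_powers x" using wP by simp
  }
qed

lemma carrier_gen_subloop_subset_int_powers: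
  "x \<in> carrier X \<Longrightarrow> carrier (gen_subloop X x) \<subseteq> int_powers x"
  using carrier_gen_subloop_subset subloop_int_powers self_in_int_powers by blast

lemma gen_subloop_group:
  assumes x: "x \<in> carrier X"
  shows "group (gen_subloop X x)"
proof -
  define H where "H = carrier (gen_subloop X x)"
  have H: "subloop H X" unfolding H_def by (rule subloop_gen_subloop[OF x])
  have HX: "H \<subseteq> carrier X" using H by (simp add: subloop_def)
  have HP: "H \<subseteq> int_powers x"
    unfolding H_def by (rule carrier_gen_subloop_subset_int_powers[OF x])
  have gen: "gen_subloop X x = X\<lparr>carrier := H\<rparr>" by (simp add: H_def gen_subloop_def)
  interpret L: loop "X\<lparr>carrier := H\<rparr>" using H by (simp add: subloop_def)
  show ?thesis unfolding gen
  proof (rule groupI, simp_all add: subloop_one[OF H] subloop_mult[OF H])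
    fix u v w assume uvw: "u \<in> H" "v \<in> H" "w \<in> H"
    then have "R (v \<otimes> w) u = (R w \<otimes>\<^bsub>Sym\<^esub> R v) u"
      using R_mult_int_powers[OF x] HP by (metis subsetD)
    moreover have "u \<in> carrier X" "v \<in> carrier X" "w \<in> carrier X" using uvw HX by auto
    ultimately show "u \<otimes> v \<otimes> w = u \<otimes> (v \<otimes> w)"
      by (simp add: Sym_mult_apply R_closed R_apply mult_closed)
  next
    fix u assume "u \<in> H"
    then show "\<one> \<otimes> u = u" using left_one HX by blast
    show "\<exists>v\<in>H. v \<otimes> u = \<one>"
      using L.right_divide[of u \<one>] \<open>u \<in> H\<close> subloop_one[OF H] by auto
  qed
qed

lemma self_in_gen_subloop: "x \<in> carrier (gen_subloop X x)"
  by (simp add: gen_subloop_def)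

lemma loop_inv_closed:
  assumes x: "x \<in> carrier X" shows "loop_inv X x \<in> carrier X"
proof -
  interpret H: group "gen_subloop X x" by (rule gen_subloop_group[OF x])
  have "loop_inv X x \<in> carrier (gen_subloop X x)"
    using H.inv_closed[OF self_in_gen_subloop] by (simp add: loop_inv_def)
  then show ?thesis using subloop_gen_subloop[OF x] by (auto simp: subloop_def)
qed

lemma loop_inv_mult:
  assumes x: "x \<in> carrier X" shows "loop_inv X x \<otimes> x = \<one>"
proof -
  interpret H: group "gen_subloop X x" by (rule gen_subloop_group[OF x])
  show ?thesis
    using H.l_inv[OF self_in_gen_subloop] by (simp add: loop_inv_def gen_subloop_def)
qed

lemma R_loop_inv:
  assumes x: "x \<in> carrier X" shows "R (loop_inv X x) = inv\<^bsub>Sym\<^esub> (R x)"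
proof -
  obtain u where u: "u \<in> carrier X" "R u = inv\<^bsub>Sym\<^esub> (R x)"
    using inv_R_ex[OF x] by blast
  interpret S: group Sym by (rule group_Sym)
  have "u \<otimes> x = \<one>"
    using R_mult_at_one[OF u(1) x] u R_closed[OF x] one_in_carrier
    by (simp add: R_apply left_one flip: R_one)
  then have "u = loop_inv X x"
    using right_cancel loop_inv_mult loop_inv_closed x u(1) by metis
  then show ?thesis using u by simp
qed

text \<open>
  The map \<open>R\<close> turns powers of \<open>x\<close> in the subloop generated by \<open>x\<close> into powers of \<open>R x\<close>.
  For infinite order \<^const>\<open>loop_ord\<close> is 0 and the equation is trivial.
\<close>

lemma R_pow_loop_ord:
  assumes x: "x \<in> carrier X" shows "R x [^]\<^bsub>Sym\<^esub> loop_ord X x = \<one>\<^bsub>Sym\<^esub>"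
proof -
  interpret S: group Sym by (rule group_Sym)
  interpret H: group "gen_subloop X x" by (rule gen_subloop_group[OF x])
  have HP: "carrier (gen_subloop X x) \<subseteq> int_powers x"
    by (rule carrier_gen_subloop_subset_int_powers[OF x])
  have mult: "u \<otimes>\<^bsub>gen_subloop X x\<^esub> v = u \<otimes> v" and one: "\<one>\<^bsub>gen_subloop X x\<^esub> = \<one>" for u v
    by (simp_all add: gen_subloop_def)
  have pow: "R (x [^]\<^bsub>gen_subloop X x\<^esub> n) = R x [^]\<^bsub>Sym\<^esub> n" for n :: nat
  proof (induction n)
    case 0
    then show ?case by (simp add: one R_one)
  next
    case (Suc n)
    have "x [^]\<^bsub>gen_subloop X x\<^esub> n \<in> int_powers x"
      using HP H.nat_pow_closed[OF self_in_gen_subloop] by blast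
    then have "R (x [^]\<^bsub>gen_subloop X x\<^esub> Suc n) = R x \<otimes>\<^bsub>Sym\<^esub> R (x [^]\<^bsub>gen_subloop X x\<^esub> n)"
      using R_mult_int_powers[OF x _ self_in_int_powers[OF x]] by (simp add: mult)
    then show ?case using Suc R_closed[OF x] S.nat_pow_Suc2 by simp
  qed
  show ?thesis
    using pow[of "loop_ord X x"] H.pow_ord_eq_1[OF self_in_gen_subloop]
    by (simp add: loop_ord_def one R_one)
qed

lemma R_square:
  assumes x: "x \<in> carrier X" shows "R (x \<otimes> x) = R x \<otimes>\<^bsub>Sym\<^esub> R x"
  using R_mult_int_powers[OF x self_in_int_powers[OF x] self_in_int_powers[OF x]] .

end

section \<open>Bruck loops\<close>

context bruck_loop
begin

text \<open>
  Write \<open>i\<close> for the inverse of \<open>x y\<close>, which is the product of the inverses of \<open>x\<close> and \<open>y\<close>.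
  Multiplying \<open>i\<close> by \<open>y\<close>, \<open>x\<close>, \<open>x\<close>, \<open>y\<close> in turn gives the inverse of \<open>x\<close>, the
  identity, \<open>x\<close>, and \<open>x y\<close>. Multiplying \<open>i\<close> by the square of \<open>x y\<close> also gives \<open>x y\<close>, so the
  two right factors agree.
\<close>

lemma square_of_product:
  assumes x: "x \<in> carrier X" and y: "y \<in> carrier X"
  shows "(x \<otimes> y) \<otimes> (x \<otimes> y) = (y \<otimes> (x \<otimes> x)) \<otimes> y"
proof -
  interpret S: group Sym by (rule group_Sym)
  have cancel: "(v \<otimes> loop_inv X u) \<otimes> u = v" "loop_inv X u \<otimes> (u \<otimes> u) = u"
    if "u \<in> carrier X" "v \<in> carrier X" for u v
  proof -
    note [simp] = that R_closed loop_inv_closed R_apply mult_closed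
    have "(R u \<otimes>\<^bsub>Sym\<^esub> R (loop_inv X u)) v = v"
      by (simp add: R_loop_inv) (simp add: right_one flip: R_one)
    then show "(v \<otimes> loop_inv X u) \<otimes> u = v" by (simp add: Sym_mult_apply)
    have sq: "(w \<otimes> u) \<otimes> u = w \<otimes> (u \<otimes> u)" if "w \<in> carrier X" for w
      using fun_cong[OF R_square[OF \<open>u \<in> carrier X\<close>], of w] that by (simp add: Sym_mult_apply)
    show "loop_inv X u \<otimes> (u \<otimes> u) = u"
      using sq[of "loop_inv X u"] by (simp add: loop_inv_mult left_one)
  qed
  let ?i = "loop_inv X (x \<otimes> y)"
  note [simp] = x y mult_closed loop_inv_closed
  have "?i \<otimes> ((y \<otimes> (x \<otimes> x)) \<otimes> y) = ((?i \<otimes> y) \<otimes> (x \<otimes> x)) \<otimes> y"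
    by (simp add: bol)
  also have "?i \<otimes> y = loop_inv X x"
    by (simp add: inv_mult cancel)
  also have "(loop_inv X x \<otimes> (x \<otimes> x)) \<otimes> y = x \<otimes> y"
    using cancel(2)[OF x x] by simp
  also have "\<dots> = ?i \<otimes> ((x \<otimes> y) \<otimes> (x \<otimes> y))"
    using cancel(2)[of "x \<otimes> y" x] by simp
  finally show ?thesis
    using left_cancel[of ?i] by (metis loop_inv_closed mult_closed x y)
qed

text \<open>
  The induction hypothesis is applied to the square of \<open>x\<close>, whose translation is annihilated by
  half the exponent; it is the commutation contained in the two product formulas that is needed
  there. The formulas for \<open>x\<close> follow by identifying \<open>c b\<^sup>-\<^sup>1\<close> with \<open>R x\<close>, where \<open>b = R y\<close>
  and \<open>c = R (x y)\<close>.
\<close>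

lemma R_mult_if_two_element_odd:
  assumes y: "y \<in> carrier X" and m: "R y [^]\<^bsub>Sym\<^esub> m = \<one>\<^bsub>Sym\<^esub>" "odd (m::nat)"
    and x: "x \<in> carrier X" and k: "R x [^]\<^bsub>Sym\<^esub> (2 ^ k :: nat) = \<one>\<^bsub>Sym\<^esub>"
  shows "R x \<otimes>\<^bsub>Sym\<^esub> R y = R (x \<otimes> y) \<and> R y \<otimes>\<^bsub>Sym\<^esub> R x = R (x \<otimes> y)"
  using x k
proof (induction k arbitrary: x)
  interpret S: group Sym by (rule group_Sym)
  case 0
  then have "R x = \<one>\<^bsub>Sym\<^esub>" using R_closed by simp
  moreover from this have "x = \<one>"
    using R_eqI_at_one[of x "R \<one>"] 0 R_apply[of \<one> \<one>] one_in_carrier left_one by (simp add: R_one)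
  ultimately show ?case using y R_closed left_one by simp
next
  interpret S: group Sym by (rule group_Sym)
  case (Suc k)
  note x = \<open>x \<in> carrier X\<close>
  have xy: "x \<otimes> y \<in> carrier X" using x y mult_closed by blast
  note carr = R_closed[OF x] R_closed[OF y] R_closed[OF xy]
  define s where "s = R (x \<otimes> x)"
  have sx: "s = R x \<otimes>\<^bsub>Sym\<^esub> R x" unfolding s_def by (rule R_square[OF x])
  have s: "s \<in> carrier Sym" using sx carr by simp
  have "s [^]\<^bsub>Sym\<^esub> (2 ^ k :: nat) = \<one>\<^bsub>Sym\<^esub>"
    using Suc.prems S.nat_pow_pow[OF carr(1), of 2 "2 ^ k"] sx carr
    by (simp add: numeral_2_eq_2)
  moreover from this have sy: "s \<otimes>\<^bsub>Sym\<^esub> R y = R y \<otimes>\<^bsub>Sym\<^esub> s"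
    using Suc.IH[of "x \<otimes> x"] x mult_closed by (simp add: s_def)
  moreover have "R (x \<otimes> y) \<otimes>\<^bsub>Sym\<^esub> R (x \<otimes> y) = s \<otimes>\<^bsub>Sym\<^esub> (R y \<otimes>\<^bsub>Sym\<^esub> R y)"
  proof -
    have "R (x \<otimes> y) \<otimes>\<^bsub>Sym\<^esub> R (x \<otimes> y) = R y \<otimes>\<^bsub>Sym\<^esub> s \<otimes>\<^bsub>Sym\<^esub> R y"
      using R_square[OF xy] square_of_product[OF x y] R_sandwich[OF y, of "x \<otimes> x"] x mult_closed
      by (simp add: s_def)
    then show ?thesis using sy s carr by (metis S.m_assoc)
  qed
  ultimately have comm: "R (x \<otimes> y) \<otimes>\<^bsub>Sym\<^esub> R y = R y \<otimes>\<^bsub>Sym\<^esub> R (x \<otimes> y)"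
    using S.commutes_if_square_eq_odd_times_two_part[OF s carr(2,3)] m by blast
  \<comment> \<open>With \<open>m = 2 j + 1\<close>, the \<open>j\<close>-th power of \<open>R y\<close> is a square root of its inverse.\<close>
  obtain j where j: "m = Suc (2 * j)" using m(2) by (metis oddE Suc_eq_plus1)
  obtain w where w: "w \<in> carrier X" "R w = R y [^]\<^bsub>Sym\<^esub> j"
    using R_nat_pow_ex[OF y] by blast
  define e where "e = (w \<otimes> (x \<otimes> y)) \<otimes> w"
  have e: "e \<in> carrier X" using w xy mult_closed by (simp add: e_def)
  have pow: "R y [^]\<^bsub>Sym\<^esub> n \<otimes>\<^bsub>Sym\<^esub> R (x \<otimes> y) = R (x \<otimes> y) \<otimes>\<^bsub>Sym\<^esub> R y [^]\<^bsub>Sym\<^esub> n" for n :: nat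
    using S.group_commutes_pow[of "R y" "R (x \<otimes> y)" n] comm carr by simp
  have Re: "R e = R (x \<otimes> y) \<otimes>\<^bsub>Sym\<^esub> R y [^]\<^bsub>Sym\<^esub> (2 * j)"
    using R_sandwich[OF w(1) xy] w(2) pow[of j] carr
    by (simp add: e_def S.m_assoc S.nat_pow_mult mult_2)
  then have ey: "R e \<otimes>\<^bsub>Sym\<^esub> R y = R (x \<otimes> y)"
    using m(1) carr by (simp add: j S.m_assoc)
  have ye: "R y \<otimes>\<^bsub>Sym\<^esub> R e = R (x \<otimes> y)"
  proof -
    have "R y \<otimes>\<^bsub>Sym\<^esub> R e = R (x \<otimes> y) \<otimes>\<^bsub>Sym\<^esub> (R y \<otimes>\<^bsub>Sym\<^esub> R y [^]\<^bsub>Sym\<^esub> (2 * j))"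
      unfolding Re using comm carr by (simp flip: S.m_assoc)
    also have "R y \<otimes>\<^bsub>Sym\<^esub> R y [^]\<^bsub>Sym\<^esub> (2 * j) = \<one>\<^bsub>Sym\<^esub>"
      using m(1) S.nat_pow_Suc2[OF carr(2), of "2 * j"] by (simp add: j)
    finally show ?thesis using carr by simp
  qed
  have "e \<otimes> y = x \<otimes> y"
    using R_mult_at_one[OF e y] ye R_eqI_at_one[OF refl xy] by simp
  then have "e = x" using right_cancel e x y by blast
  then show ?case using ey ye by simp
qed

end

theorem theorem2:
  fixes X :: "('a, 'b) monoid_scheme" (structure) and x y :: 'a
  assumes "bruck_loop X"
    and "x \<in> carrier X" and "y \<in> carrier X"
    and "\<exists>k::nat. loop_ord X x = 2 ^ k"
    and "odd (loop_ord X y)"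
  shows "perm_prod X (right_translation X x) (right_translation X y)
           = right_translation X (x \<otimes> y)
       \<and> right_translation X (x \<otimes> y) = right_translation X (y \<otimes> x)
       \<and> right_translation X (y \<otimes> x)
           = perm_prod X (right_translation X y) (right_translation X x)
       \<and> x \<otimes> y = y \<otimes> x"
proof -
  interpret bruck_loop X by (rule assms(1))
  note xy = assms(2,3)
  obtain k :: nat where k: "loop_ord X x = 2 ^ k" using assms(4) by blast
  have prods: "R x \<otimes>\<^bsub>Sym\<^esub> R y = R (x \<otimes> y)" "R y \<otimes>\<^bsub>Sym\<^esub> R x = R (x \<otimes> y)"
    using R_mult_if_two_element_odd[OF xy(2) R_pow_loop_ord[OF xy(2)] assms(5) xy(1), of k]
      R_pow_loop_ord[OF xy(1)] k by simp_all
  have "x \<otimes> y = y \<otimes> x"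
    using R_mult_at_one[OF xy] R_mult_at_one[OF xy(2,1)] prods by simp
  moreover have "perm_prod X (R u) (R v) = R v \<otimes>\<^bsub>Sym\<^esub> R u"
    if "u \<in> carrier X" "v \<in> carrier X" for u v
    using R_closed[OF that(1)] R_closed[OF that(2)] by (simp add: perm_prod_def BijGroup_def)
  ultimately show ?thesis using prods xy by simp
qed

end
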